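(* Let $\psi$ be a fast majorant, and let $\mathscr{E}$ be an $\mathscr{L}_{\psi}$-extension domain of $\mathbb{C}^{n}$. Let $f=u+iv$ be holomorphic in $\mathscr{E}$, where $u$ and $v$ are real-valued pluriharmonic functions in $\mathscr{E}$. Then the following statements are equivalent. ($\mathscr{C}_{1}$) $u\in\mathscr{L}_{\psi}(\mathscr{E})$; ($\mathscr{C}_{2}$) there is a positive constant $C$ such that $|\nabla u(z)|\leq C\,\dfrac{\psi(d_{\mathscr{E}}(z))}{d_{\mathscr{E}}(z)}$ for all $z\in\mathscr{E}$; ($\mathscr{C}_{3}$) $|u|\in\mathscr{L}_{\psi}(\mathscr{E})$; ($\mathscr{C}_{4}$) for a given $p$, where $p\geq\frac{2n-2}{2n-1}$ if $n\geq2$ and $p>0$ if $n=1$, there is a positive constant $C$ such that $I_{u,p}(z)\leq C\,\dfrac{\psi(d_{\mathscr{E}}(z))}{d_{\mathscr{E}}(z)}$ for all $z\in\mathscr{E}$; ($\mathscr{C}_{5}$) $v\in\mathscr{L}_{\psi}(\mathscr{E})$; ($\mathscr{C}_{6}$) there is a positive constant $C$ such that $|\nabla v(z)|\leq C\,\dfrac{\psi(d_{\mathscr{E}}(z))}{d_{\mathscr{E}}(z)}$ for all $z\in\mathscr{E}$; ($\mathscr{C}_{7}$) $|v|\in\mathscr{L}_{\psi}(\mathscr{E})$; ($\mathscr{C}_{8}$) for a given $p$, where $p\geq\frac{2n-2}{2n-1}$ if $n\geq2$ and $p>0$ if $n=1$, there is a positive constant $C$ such that $I_{v,p}(z)\leq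 C\,\dfrac{\psi(d_{\mathscr{E}}(z))}{d_{\mathscr{E}}(z)}$ for all $z\in\mathscr{E}$; ($\mathscr{C}_{9}$) $f\in\mathscr{L}_{\psi}(\mathscr{E})$; ($\mathscr{C}_{10}$) $|f|\in\mathscr{L}_{\psi}(\mathscr{E})$; ($\mathscr{C}_{11}$) $|f|\in\mathscr{L}_{\psi}(\mathscr{E},\partial\mathscr{E})$.
   Context: A twice continuously differentiable function is pluriharmonic if $\partial^2/\partial z_j\partial\overline{z}_k$ of it vanishes for all $j,k$. Majorants: a continuous increasing function $\psi:[0,\infty)\to[0,\infty)$ with $\psi(0)=0$ is a majorant if $\psi(t)/t$ is non-increasing for $t>0$. A majorant $\psi$ is fast if there are $\delta_0>0$ and $C>0$ such that $\int_0^\delta\frac{\psi(t)}{t}dt\leq C\psi(\delta)$ for all $0<\delta<\delta_0$. Lipschitz spaces: let $D$ be a proper subdomain of $\mathbb{C}^n$ and $d_D(z)$ the Euclidean distance from $z$ to $\partial D$. A function $F:D\to\mathbb{C}$ (or $\mathbb{R}$) belongs to $\mathscr{L}_\psi(D)$ if there is a constant $C=C(F)>0$ with $|F(z)-F(w)|\leq C\psi(|z-w|)$ for all $z,w\in D$. It belongs to $\mathrm{loc}\mathscr{L}_\psi(D)$ if this inequality holds, with a fixed positive constant $C$, whenever $z\in D$ and $|z-w|<\frac12 d_D(z)$. $D$ is an $\mathscr{L}_\psi$-extension domain if $\mathscr{L}_\psi(D)=\mathrm{loc}\mathscr{L}_\psi(D)$. For sets $E_1,E_2$, $\mathscr{L}_\psi(E_1,E_2)$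 is the class of continuous functions $F$ on $E_1\cup E_2$ satisfying $|F(z)-F(w)|\leq C\psi(|z-w|)$, with some constant $C=C(F)>0$, whenever $z\in E_1$ and $w\in E_2$. Gradient: with $z=(x_1+iy_1,\ldots,x_n+iy_n)$, $\nabla u=(u_{x_1},u_{y_1},\ldots,u_{x_n},u_{y_n})$. Means: with $\mathbb{B}^n(z,r)$ the open Euclidean ball, $|\cdot|$ of a set its Lebesgue measure and $d\mu$ Lebesgue measure, $$I_{u,p}(z)=\left(\frac{1}{|\mathbb{B}^n(z,d_{\mathscr{E}}(z)/2)|}\int_{\mathbb{B}^n(z,d_{\mathscr{E}}(z)/2)}|\nabla u(w)|^p\,d\mu(w)\right)^{1/p},$$ and $I_{v,p}$ is defined in the same way with $v$ in place of $u$. *)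

theory Defs
  imports "HOL-Analysis.Analysis"
begin

text \<open>Only the values of a majorant on the half-line \<open>{0..}\<close> matter.
  ``Increasing'' is read in the weak sense, which includes all strictly increasing majorants.\<close>

definition majorant :: "(real \<Rightarrow> real) \<Rightarrow> bool" where
  "majorant \<psi> \<longleftrightarrow>
     continuous_on {0..} \<psi> \<and> mono_on {0..} \<psi> \<and> (\<forall>t\<ge>0. 0 \<le> \<psi> t) \<and> \<psi> 0 = 0 \<and>
     antimono_on {0<..} (\<lambda>t. \<psi> t / t)"

text \<open>The nonnegative integral is used so that a divergent integral is infinite and
  therefore violates the bound.\<close>

definition fast_majorant :: "(real \<Rightarrow> real) \<Rightarrow> bool" where
  "fast_majorant \<psi> \<longleftrightarrow> majorant \<psi> \<and>
     (\<exists>\<delta>0>0. \<exists>C>0. \<forall>\<delta>. 0 < \<delta> \<and> \<delta> < \<delta>0 \<longrightarrow>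
        (\<integral>\<^sup>+t\<in>{0<..<\<delta>}. ennreal (\<psi> t / t) \<partial>lborel) \<le> ennreal (C * \<psi> \<delta>))"

definition proper_domain :: "'a::topological_space set \<Rightarrow> bool" where
  "proper_domain D \<longleftrightarrow> open D \<and> connected D \<and> D \<noteq> {} \<and> D \<noteq> UNIV"

definition bdist :: "'a::metric_space set \<Rightarrow> 'a \<Rightarrow> real" where
  "bdist D z = infdist z (frontier D)"

text \<open>Functions on \<open>D\<close> are represented by total functions; membership in the following
  classes depends only on their values on \<open>D\<close> (on \<open>E1 \<union> E2\<close> in the third case).\<close>

definition Lip :: "(real \<Rightarrow> real) \<Rightarrow> 'a::real_normed_vector set \<Rightarrow> ('a \<Rightarrow> 'b::real_normed_vector) set" where
  "Lip \<psi> D = {F. \<exists>C>0. \<forall>z\<in>D. \<forall>w\<in>D. norm (F z - F w) \<le> C * \<psi> (norm (z - w))}"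

definition loc_Lip :: "(real \<Rightarrow> real) \<Rightarrow> 'a::real_normed_vector set \<Rightarrow> ('a \<Rightarrow> 'b::real_normed_vector) set" where
  "loc_Lip \<psi> D = {F. \<exists>C>0. \<forall>z\<in>D. \<forall>w. norm (z - w) < bdist D z / 2 \<longrightarrow>
     norm (F z - F w) \<le> C * \<psi> (norm (z - w))}"

definition Lip2 ::
  "(real \<Rightarrow> real) \<Rightarrow> 'a::real_normed_vector set \<Rightarrow> 'a set \<Rightarrow> ('a \<Rightarrow> 'b::real_normed_vector) set" where
  "Lip2 \<psi> E1 E2 = {F. continuous_on (E1 \<union> E2) F \<and>
     (\<exists>C>0. \<forall>z\<in>E1. \<forall>w\<in>E2. norm (F z - F w) \<le> C * \<psi> (norm (z - w)))}"

text \<open>Stated for complex-valued functions, which includes the real-valued ones.\<close>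

definition extension_domain :: "(real \<Rightarrow> real) \<Rightarrow> (complex ^ 'n) set \<Rightarrow> bool" where
  "extension_domain \<psi> D \<longleftrightarrow> proper_domain D \<and>
     (Lip \<psi> D :: (complex ^ 'n \<Rightarrow> complex) set) = loc_Lip \<psi> D"

definition holomorphic_Cn :: "(complex ^ 'n \<Rightarrow> complex) \<Rightarrow> (complex ^ 'n) set \<Rightarrow> bool" where
  "holomorphic_Cn f D \<longleftrightarrow>
     (\<forall>z\<in>D. \<exists>L. (f has_derivative L) (at z) \<and> Vector_Spaces.linear (*s) (*) L)"

definition partial_x :: "'n \<Rightarrow> (complex ^ 'n \<Rightarrow> 'b::real_normed_vector) \<Rightarrow> complex ^ 'n \<Rightarrow> 'b" where
  "partial_x j F z = frechet_derivative F (at z) (axis j 1)"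

definition partial_y :: "'n \<Rightarrow> (complex ^ 'n \<Rightarrow> 'b::real_normed_vector) \<Rightarrow> complex ^ 'n \<Rightarrow> 'b" where
  "partial_y j F z = frechet_derivative F (at z) (axis j \<i>)"

definition C1_on :: "(complex ^ 'n) set \<Rightarrow> (complex ^ 'n \<Rightarrow> 'b::real_normed_vector) \<Rightarrow> bool" where
  "C1_on D F \<longleftrightarrow> (\<forall>z\<in>D. F differentiable (at z)) \<and>
     (\<forall>j. continuous_on D (partial_x j F) \<and> continuous_on D (partial_y j F))"

definition C2_on :: "(complex ^ 'n) set \<Rightarrow> (complex ^ 'n \<Rightarrow> 'b::real_normed_vector) \<Rightarrow> bool" where
  "C2_on D F \<longleftrightarrow> C1_on D F \<and> (\<forall>j. C1_on D (partial_x j F) \<and> C1_on D (partial_y j F))"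

definition wirtinger :: "'n \<Rightarrow> (complex ^ 'n \<Rightarrow> complex) \<Rightarrow> complex ^ 'n \<Rightarrow> complex" where
  "wirtinger j F z = (partial_x j F z - \<i> * partial_y j F z) / 2"

definition wirtinger_bar :: "'n \<Rightarrow> (complex ^ 'n \<Rightarrow> complex) \<Rightarrow> complex ^ 'n \<Rightarrow> complex" where
  "wirtinger_bar j F z = (partial_x j F z + \<i> * partial_y j F z) / 2"

definition pluriharmonic_on :: "(complex ^ 'n) set \<Rightarrow> (complex ^ 'n \<Rightarrow> real) \<Rightarrow> bool" where
  "pluriharmonic_on D u \<longleftrightarrow> C2_on D u \<and>
     (\<forall>z\<in>D. \<forall>j k. wirtinger j (wirtinger_bar k (\<lambda>w. complex_of_real (u w))) z = 0)"

text \<open>The real gradient \<open>(u\<^sub>x\<^sub>1, u\<^sub>y\<^sub>1, \<dots>, u\<^sub>x\<^sub>n, u\<^sub>y\<^sub>n)\<close>, with each pair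
  \<open>(u\<^sub>x\<^sub>j, u\<^sub>y\<^sub>j)\<close> packed into one complex coordinate; this preserves the Euclidean norm.\<close>

definition grad :: "(complex ^ 'n \<Rightarrow> real) \<Rightarrow> complex ^ 'n \<Rightarrow> complex ^ 'n" where
  "grad u z = (\<chi> j. Complex (partial_x j u z) (partial_y j u z))"

definition grad_mean ::
  "(complex ^ 'n) set \<Rightarrow> (complex ^ 'n \<Rightarrow> real) \<Rightarrow> real \<Rightarrow> complex ^ 'n \<Rightarrow> real" where
  "grad_mean D u p z =
     (1 / measure lebesgue (ball z (bdist D z / 2)) *
      (LINT w:ball z (bdist D z / 2)|lebesgue. norm (grad u w) powr p)) powr (1 / p)"

text \<open>The admissible exponents in complex dimension \<open>n\<close>.\<close>

definition admissible_exponent :: "nat \<Rightarrow> real \<Rightarrow> bool" where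
  "admissible_exponent n p \<longleftrightarrow>
     (n \<ge> 2 \<longrightarrow> p \<ge> (2 * real n - 2) / (2 * real n - 1)) \<and> (n = 1 \<longrightarrow> p > 0)"

end

theory Submission
  imports Defs "HOL-Complex_Analysis.Cauchy_Integral_Formula"
begin

text \<open>All eleven conditions are shown to be equivalent to one growth condition on the complex gradient
\<open>f' = (\<partial>f/\<partial>z\<^sub>1, \<dots>, \<partial>f/\<partial>z\<^sub>n)\<close>: with \<open>d\<close> the distance to the boundary,
\<open>\<bar>f'(z)\<bar>\<close> is at most a constant times \<open>\<psi>(d(z)) / d(z)\<close>. By the Cauchy-Riemann equations \<open>\<bar>\<nabla>u\<bar>\<close> and
\<open>\<bar>\<nabla>v\<bar>\<close> both equal \<open>\<bar>f'\<bar>\<close>, so the two pointwise gradient conditions are this condition itself.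

From growth to Lipschitz: on a segment of length \<open>t < d(z)/2\<close> starting at \<open>z\<close> every point has
boundary distance at least \<open>t\<close>. As \<open>\<psi>(t)/t\<close> is non-increasing, \<open>\<bar>f'\<bar>\<close> is at most a multiple of
\<open>\<psi>(t)/t\<close> there, and the increment of \<open>f\<close> is at most a multiple of \<open>\<psi>(t)\<close>. So \<open>f\<close> is locally
Lipschitz, hence Lipschitz because \<open>E\<close> is an extension domain
(\<open>Lip_if_growth_bounded_complex_grad\<close>). Then \<open>Re f\<close>, \<open>Im f\<close>, their absolute values and \<open>\<bar>f\<bar>\<close> are
Lipschitz as well.

From Lipschitz to growth: a Borel-Caratheodory type estimate bounds \<open>\<bar>f'(z)\<bar>\<close> as soon as
\<open>Re (c (f(w) - f(z)))\<close> is bounded above, for a single unimodular \<open>c\<close>, on the ball of radius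
\<open>d(z)/2\<close>. For each of the functions \<open>Re\<close>, \<open>Im\<close>, \<open>\<bar>Re\<bar>\<close>, \<open>\<bar>Im\<bar>\<close> and the modulus, such a \<open>c\<close>
(depending on \<open>f(z)\<close>) turns the oscillation of the function along \<open>f\<close> into an upper bound of this
kind. This common property is called \<open>directional_gauge\<close>, and it treats all five conditions at
once. The Lipschitz condition between \<open>E\<close> and its boundary also controls this oscillation: compare
the values at \<open>w\<close> and \<open>z\<close> with the value at a boundary point nearest to \<open>z\<close>. Conversely,
a function in the Lipschitz class is uniformly continuous and extends to the closure with the same
estimate.

Means of powers: growth bounds the mean because the quotient \<open>\<psi>(d)/d\<close> at most doubles on the ball
of radius \<open>d(z)/2\<close>. In the converse direction, for arbitrary \<open>p > 0\<close>, a maximum argument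
bounds the value at the centre by the mean (\<open>centre_le_powr_mean\<close>). A suitably weighted maximum of
\<open>\<bar>f'\<bar>\<close> is attained at a point \<open>w\<close> around which \<open>\<bar>f'\<bar>\<close> is at most a fixed multiple of \<open>\<bar>f'(w)\<bar>\<close>;
Cauchy's estimate (\<open>complex_grad_oscillation\<close>) then keeps \<open>\<bar>f'\<bar>\<close> above \<open>\<bar>f'(w)\<bar>/2\<close> on a smaller
ball, and this ball alone makes the mean large.\<close>

section \<open>A derivative bound from a one-sided bound on the real part\<close>

text \<open>The Moebius map \<open>s / (2B - s)\<close> fixes \<open>0\<close> and takes the half-plane \<open>Re s < B\<close> into the unit disc.
Composed with \<open>h - h 0\<close>, Cauchy's inequality gives the bound with any \<open>B > K\<close> in place of \<open>K\<close>.
The strict inequality keeps the denominator away from zero also when \<open>K = 0\<close>.\<close>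

lemma norm_deriv_le_of_Re_le:
  fixes h :: "complex \<Rightarrow> complex"
  assumes hol: "h holomorphic_on ball 0 R" and r: "0 < r" "r < R"
    and Re_le: "\<And>\<zeta>. \<zeta> \<in> cball 0 r \<Longrightarrow> Re (h \<zeta> - h 0) \<le> K"
  shows "norm (deriv h 0) \<le> 2 * K / r"
proof -
  have bound: "norm (deriv h 0) \<le> 2 * B / r" if "K < B" for B
  proof -
    have "0 \<le> K"
      using Re_le[of 0] r by simp
    then have "0 < B" using that by simp
    define \<phi> where "\<phi> = (\<lambda>\<zeta>. (h \<zeta> - h 0) / (2 * of_real B - (h \<zeta> - h 0)))"
    have lt: "Re (h \<zeta> - h 0) < B" if "\<zeta> \<in> cball 0 r" for \<zeta>
      using Re_le[OF that] \<open>K < B\<close> by simp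
    have nz: "2 * of_real B - (h \<zeta> - h 0) \<noteq> 0" if "\<zeta> \<in> cball 0 r" for \<zeta>
    proof
      assume "2 * of_real B - (h \<zeta> - h 0) = 0"
      then have "Re (2 * of_real B - (h \<zeta> - h 0)) = 0" by simp
      then show False using lt[OF that] \<open>0 < B\<close> by simp
    qed
    have nrm: "norm (\<phi> \<zeta>) \<le> 1" if "\<zeta> \<in> cball 0 r" for \<zeta>
    proof -
      define s where "s = h \<zeta> - h 0"
      have "Re s < B" using lt[OF that] by (simp add: s_def)
      \<comment> \<open>A point of the half-plane is closer to 0 than to \<open>2B\<close>, the reflection of 0 in its boundary.\<close>
      then have "\<bar>Re s\<bar> \<le> \<bar>2 * B - Re s\<bar>" using \<open>0 < B\<close> by linarith
      then have "(Re s)\<^sup>2 \<le> (2 * B - Re s)\<^sup>2" by (simp add: abs_le_square_iff)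
      then have "norm s \<le> norm (2 * of_real B - s)"
        by (simp add: cmod_def)
      then show ?thesis
        unfolding \<phi>_def s_def[symmetric] using nz[OF that]
        by (simp add: norm_divide s_def[symmetric] divide_le_eq)
    qed
    have hol_r: "h holomorphic_on cball 0 r"
      by (rule holomorphic_on_subset[OF hol]) (use r in auto)
    have hol_\<phi>: "\<phi> holomorphic_on cball 0 r"
      unfolding \<phi>_def by (intro holomorphic_intros hol_r) (use nz in auto)
    have "norm ((deriv ^^ 1) \<phi> 0) \<le> fact 1 * 1 / r ^ 1"
    proof (rule Cauchy_inequality)
      show "\<phi> holomorphic_on ball 0 r"
        by (rule holomorphic_on_subset[OF hol_\<phi>]) auto
      show "continuous_on (cball 0 r) \<phi>"
        by (rule holomorphic_on_imp_continuous_on[OF hol_\<phi>])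
      show "norm (\<phi> \<zeta>) \<le> 1" if "norm (0 - \<zeta>) = r" for \<zeta>
        using that by (intro nrm) simp
    qed (use r in auto)
    then have \<phi>': "norm (deriv \<phi> 0) \<le> 1 / r" by simp
    have h': "(h has_field_derivative deriv h 0) (at 0)"
      by (rule holomorphic_derivI[OF hol]) (use r in auto)
    have "(\<phi> has_field_derivative deriv h 0 / (2 * of_real B)) (at 0)"
      unfolding \<phi>_def by (rule derivative_eq_intros h' refl | use nz[of 0] r in simp)+
    then have "deriv \<phi> 0 = deriv h 0 / (2 * of_real B)"
      by (rule DERIV_imp_deriv)
    with \<phi>' have "norm (deriv h 0) / (2 * B) \<le> 1 / r"
      using \<open>0 < B\<close> by (simp add: norm_divide norm_mult)
    then show ?thesis using \<open>0 < B\<close> r by (simp add: field_simps)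
  qed
  have "norm (deriv h 0) * r / 2 \<le> K"
  proof (rule dense_ge)
    show "norm (deriv h 0) * r / 2 \<le> B" if "K < B" for B
      using bound[OF that] r by (simp add: field_simps)
  qed
  then show ?thesis using r by (simp add: field_simps)
qed

section \<open>Majorants and the distance to the boundary\<close>

lemma majorant_scale_le:
  assumes "majorant \<psi>" "1 \<le> c" "0 \<le> t"
  shows "\<psi> (c * t) \<le> c * \<psi> t"
proof (cases "t = 0")
  case True
  then show ?thesis using assms by (simp add: majorant_def)
next
  case False
  then have t: "0 < t" "t \<le> c * t" using assms by auto
  then have "\<psi> (c * t) / (c * t) \<le> \<psi> t / t"
    using assms(1) unfolding majorant_def monotone_on_def by auto
  then show ?thesis using t assms(2) by (simp add: field_simps)
qed

text \<open>The quotient \<open>\<psi>(t)/t\<close> is essentially constant on the ball of radius \<open>d/2\<close> around a point at boundary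
distance \<open>d\<close>: it exceeds its value at the centre by at most the factor 2.\<close>

lemma majorant_quotient_half_le:
  assumes "majorant \<psi>" "0 < d" "d / 2 \<le> t"
  shows "\<psi> t / t \<le> 2 * (\<psi> d / d)"
proof -
  have anti: "antimono_on {0<..} (\<lambda>t. \<psi> t / t)"
    using assms(1) by (simp add: majorant_def)
  have "\<psi> t / t \<le> \<psi> (d/2) / (d/2)"
    by (rule monotone_onD[OF anti]) (use assms in auto)
  also have "\<psi> (d/2) \<le> \<psi> d"
    using assms unfolding majorant_def mono_on_def by auto
  then have "\<psi> (d/2) / (d/2) \<le> \<psi> d / (d/2)"
    using assms by (intro divide_right_mono) auto
  finally show ?thesis by (simp add: mult.commute)
qed

lemma frontier_proper_domain_nonempty: "proper_domain D \<Longrightarrow> frontier D \<noteq> {}"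
  for D :: "'a::real_normed_vector set"
  by (simp add: proper_domain_def frontier_eq_empty)

lemma bdist_pos:
  fixes D :: "'a::real_normed_vector set"
  assumes "proper_domain D" "z \<in> D"
  shows "0 < bdist D z"
proof -
  have "z \<notin> frontier D"
    using assms by (simp add: proper_domain_def frontier_def interior_open)
  then show ?thesis
    unfolding bdist_def
    by (simp add: infdist_pos_not_in_closed frontier_proper_domain_nonempty[OF assms(1)])
qed

text \<open>A ball is connected, so one that meets both \<open>D\<close> and its complement meets the frontier.\<close>

lemma ball_bdist_subset:
  fixes D :: "'a::real_normed_vector set"
  assumes "z \<in> D"
  shows "ball z (bdist D z) \<subseteq> D"
proof (rule ccontr)
  assume "\<not> ?thesis"
  then have ne: "ball z (bdist D z) - D \<noteq> {}" by blast
  then have "z \<in> ball z (bdist D z)"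
    using zero_le_dist order.strict_trans1 by (metis Diff_iff ex_in_conv centre_in_ball mem_ball)
  then have "ball z (bdist D z) \<inter> frontier D \<noteq> {}"
    using assms ne by (intro connected_Int_frontier) blast+
  then obtain w where "dist z w < bdist D z" "w \<in> frontier D" by auto
  then show False
    using infdist_le[of w "frontier D" z] by (simp add: bdist_def)
qed

lemma bdist_triangle: "\<bar>bdist D z - bdist D w\<bar> \<le> dist z w"
  unfolding bdist_def by (rule infdist_triangle_abs)

section \<open>The complex gradient of a holomorphic function\<close>

lemma norm_vector_scalar_mult: "norm (c *s x) = norm c * norm (x :: complex ^ 'n)"
  by (simp add: norm_vec_def norm_mult L2_set_right_distrib)

text \<open>The symmetric bilinear form on \<open>\<complex>\<^sup>n\<close>, without conjugation, so that \<open>pairing a\<close> is complex linear;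
with \<open>a\<close> the vector of partial derivatives it is the differential of a holomorphic function.\<close>

definition pairing :: "complex ^ 'n \<Rightarrow> complex ^ 'n \<Rightarrow> complex" where
  "pairing a \<xi> = (\<Sum>j\<in>UNIV. \<xi> $ j * a $ j)"

lemma norm_pairing_le: "norm (pairing a \<xi>) \<le> norm a * norm \<xi>"
proof -
  have "norm (pairing a \<xi>) \<le> (\<Sum>j\<in>UNIV. \<bar>norm (\<xi> $ j)\<bar> * \<bar>norm (a $ j)\<bar>)"
    unfolding pairing_def by (rule order_trans[OF norm_sum]) (simp add: norm_mult)
  also have "\<dots> \<le> norm \<xi> * norm a"
    unfolding norm_vec_def by (rule L2_set_mult_ineq)
  finally show ?thesis by (simp add: mult.commute)
qed

text \<open>Equality in the Cauchy-Schwarz inequality, at the conjugate of \<open>a\<close>: along this complex line the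
one-variable derivative of a holomorphic function has the modulus of the full gradient.\<close>

lemma pairing_norming_vector: "\<exists>\<xi>. norm \<xi> = 1 \<and> norm (pairing a \<xi>) = norm a"
proof (cases "a = 0")
  case True
  then show ?thesis by (intro exI[of _ "axis undefined 1"]) (simp add: pairing_def)
next
  case False
  define b where "b = (\<chi> j. cnj (a $ j))"
  have nb: "norm b = norm a" by (simp add: b_def norm_vec_def)
  have "pairing a b = of_real ((norm a)\<^sup>2)"
    by (simp add: pairing_def b_def norm_vec_def L2_set_def sum_nonneg complex_norm_square mult.commute del: of_real_power)
  then have "norm (pairing a b) = (norm a)\<^sup>2" by (simp add: norm_power)
  moreover have "pairing a (of_real c *s b) = of_real c * pairing a b" for c
    by (simp add: pairing_def sum_distrib_left mult.assoc)
  ultimately show ?thesis using False nb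
    by (intro exI[of _ "of_real (1 / norm a) *s b"])
       (simp add: norm_vector_scalar_mult norm_mult norm_divide power2_eq_square del: of_real_divide)
qed

lemma pairing_axis: "pairing a (axis j c) = c * a $ j"
proof -
  have "pairing a (axis j c) = (\<Sum>k\<in>UNIV. if k = j then c * a $ k else 0)"
    unfolding pairing_def by (rule sum.cong) (auto simp: axis_def)
  then show ?thesis by simp
qed

text \<open>For holomorphic \<open>f\<close> the derivative in the real direction of the \<open>j\<close>-th coordinate is
\<open>\<partial>f/\<partial>z\<^sub>j\<close>.\<close>

definition complex_grad :: "(complex ^ 'n \<Rightarrow> complex) \<Rightarrow> complex ^ 'n \<Rightarrow> complex ^ 'n" where
  "complex_grad f z = (\<chi> j. frechet_derivative f (at z) (axis j 1))"

lemma holomorphic_Cn_has_derivative: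
  assumes "holomorphic_Cn f D" "z \<in> D"
  shows "(f has_derivative pairing (complex_grad f z)) (at z)"
proof -
  obtain L where L: "(f has_derivative L) (at z)" "Vector_Spaces.linear (*s) (*) L"
    using assms unfolding holomorphic_Cn_def by blast
  interpret L: Vector_Spaces.linear "(*s)" "(*)" L by (rule L(2))
  have L_eq: "L = frechet_derivative f (at z)"
    by (rule frechet_derivative_at[OF L(1)])
  have "L \<xi> = pairing (complex_grad f z) \<xi>" for \<xi>
  proof -
    have "L \<xi> = L (\<Sum>j\<in>UNIV. \<xi> $ j *s axis j 1)"
      by (simp add: basis_expansion)
    also have "\<dots> = (\<Sum>j\<in>UNIV. \<xi> $ j * L (axis j 1))"
      by (simp add: L.sum L.scale)
    finally show ?thesis by (simp add: pairing_def complex_grad_def L_eq)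
  qed
  then have "L = pairing (complex_grad f z)" by (rule ext)
  with L(1) show ?thesis by simp
qed

text \<open>By the Cauchy-Riemann equations the real gradient of \<open>Re f\<close>, packed into complex coordinates, is the
conjugate of the complex gradient of \<open>f\<close>.\<close>

lemma norm_grad_Re:
  assumes "holomorphic_Cn f D" "open D" "z \<in> D" "\<And>w. w \<in> D \<Longrightarrow> u w = Re (f w)"
  shows "norm (grad u z) = norm (complex_grad f z)"
proof -
  have "((\<lambda>w. Re (f w)) has_derivative (\<lambda>\<xi>. Re (pairing (complex_grad f z) \<xi>))) (at z)"
    by (intro derivative_intros holomorphic_Cn_has_derivative[OF assms(1,3)])
  then have "(u has_derivative (\<lambda>\<xi>. Re (pairing (complex_grad f z) \<xi>))) (at z)"
    by (rule has_derivative_transform_within_open[OF _ assms(2,3)]) (simp add: assms(4))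
  then have "frechet_derivative u (at z) = (\<lambda>\<xi>. Re (pairing (complex_grad f z) \<xi>))"
    by (metis frechet_derivative_at)
  then have "grad u z = (\<chi> j. cnj (complex_grad f z $ j))"
    by (simp add: grad_def partial_x_def partial_y_def pairing_axis vec_eq_iff complex_eq_iff)
  then show ?thesis by (simp add: norm_vec_def)
qed

text \<open>The same computation gives \<open>\<i>\<close> times the conjugate of the complex gradient.\<close>

lemma norm_grad_Im:
  assumes "holomorphic_Cn f D" "open D" "z \<in> D" "\<And>w. w \<in> D \<Longrightarrow> v w = Im (f w)"
  shows "norm (grad v z) = norm (complex_grad f z)"
proof -
  have "((\<lambda>w. Im (f w)) has_derivative (\<lambda>\<xi>. Im (pairing (complex_grad f z) \<xi>))) (at z)"
    by (intro derivative_intros holomorphic_Cn_has_derivative[OF assms(1,3)])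
  then have "(v has_derivative (\<lambda>\<xi>. Im (pairing (complex_grad f z) \<xi>))) (at z)"
    by (rule has_derivative_transform_within_open[OF _ assms(2,3)]) (simp add: assms(4))
  then have "frechet_derivative v (at z) = (\<lambda>\<xi>. Im (pairing (complex_grad f z) \<xi>))"
    by (metis frechet_derivative_at)
  then have "grad v z = (\<chi> j. \<i> * cnj (complex_grad f z $ j))"
    by (simp add: grad_def partial_x_def partial_y_def pairing_axis vec_eq_iff complex_eq_iff)
  then show ?thesis by (simp add: norm_vec_def norm_mult)
qed

lemma has_field_derivative_along_complex_line:
  assumes "holomorphic_Cn f D" "w + \<zeta> *s \<xi> \<in> D"
  shows "((\<lambda>\<zeta>. f (w + \<zeta> *s \<xi>)) has_field_derivative pairing (complex_grad f (w + \<zeta> *s \<xi>)) \<xi>) (at \<zeta>)"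
proof -
  have "bounded_linear (\<lambda>\<zeta>. \<zeta> *s \<xi>)"
    by (rule bounded_linear_intro[where K = "norm \<xi>"])
       (auto simp: norm_vector_scalar_mult vector_sadd_rdistrib vec_eq_iff)
  then have "((\<lambda>\<zeta>. w + \<zeta> *s \<xi>) has_derivative (\<lambda>\<eta>. \<eta> *s \<xi>)) (at \<zeta>)"
    by (auto intro!: derivative_eq_intros bounded_linear_imp_has_derivative)
  from has_derivative_compose[OF this holomorphic_Cn_has_derivative[OF assms]]
  have "((\<lambda>\<zeta>. f (w + \<zeta> *s \<xi>)) has_derivative (\<lambda>\<eta>. pairing (complex_grad f (w + \<zeta> *s \<xi>)) (\<eta> *s \<xi>))) (at \<zeta>)" .
  moreover have "pairing a (\<eta> *s \<xi>) = pairing a \<xi> * \<eta>" for a \<eta>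
    by (simp add: pairing_def sum_distrib_left sum_distrib_right mult.assoc mult.commute mult.left_commute)
  ultimately show ?thesis
    by (simp add: has_field_derivative_def)
qed

lemma continuous_on_grad:
  assumes "C1_on D u"
  shows "continuous_on D (grad u)"
proof -
  have "continuous_on D (\<lambda>z. \<chi> j. of_real (partial_x j u z) + \<i> * of_real (partial_y j u z))"
    using assms unfolding C1_on_def
    by (intro continuous_on_vec_lambda continuous_intros) auto
  then show ?thesis by (simp add: grad_def[abs_def] Complex_eq)
qed

section \<open>Estimates for the complex gradient\<close>

text \<open>The one-variable bound is applied on the complex line through \<open>z\<close> on which the gradient is attained.
The factor \<open>c\<close> selects the half-plane in which the values of \<open>f\<close> are known to stay.\<close>

lemma norm_complex_grad_le_of_Re_le:
  assumes hol: "holomorphic_Cn f D" and sub: "ball z R \<subseteq> D" and r: "0 < r" "r < R"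
    and c: "norm c = 1"
    and Re_le: "\<And>w. w \<in> cball z r \<Longrightarrow> Re (c * (f w - f z)) \<le> K"
  shows "norm (complex_grad f z) \<le> 2 * K / r"
proof -
  obtain \<xi> where \<xi>: "norm \<xi> = 1" "norm (pairing (complex_grad f z) \<xi>) = norm (complex_grad f z)"
    using pairing_norming_vector by blast
  define h where "h \<zeta> = c * f (z + \<zeta> *s \<xi>)" for \<zeta>
  have in_D: "z + \<zeta> *s \<xi> \<in> D" if "\<zeta> \<in> ball 0 R" for \<zeta>
    using that \<xi> by (intro subsetD[OF sub]) (simp add: dist_norm norm_vector_scalar_mult)
  have deriv_h: "(h has_field_derivative c * pairing (complex_grad f (z + \<zeta> *s \<xi>)) \<xi>) (at \<zeta>)"
    if "\<zeta> \<in> ball 0 R" for \<zeta>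
    unfolding h_def
    by (intro DERIV_cmult has_field_derivative_along_complex_line[OF hol in_D[OF that]])
  then have "h holomorphic_on ball 0 R"
    unfolding holomorphic_on_open[OF open_ball] by blast
  then have "norm (deriv h 0) \<le> 2 * K / r"
  proof (rule norm_deriv_le_of_Re_le[OF _ r])
    show "Re (h \<zeta> - h 0) \<le> K" if "\<zeta> \<in> cball 0 r" for \<zeta>
      using Re_le[of "z + \<zeta> *s \<xi>"] that \<xi>(1)
      by (simp add: h_def dist_norm norm_vector_scalar_mult algebra_simps)
  qed
  moreover have "deriv h 0 = c * pairing (complex_grad f z) \<xi>"
    using deriv_h[of 0] r by (auto intro: DERIV_imp_deriv)
  ultimately show ?thesis
    using c \<xi> by (simp add: norm_mult)
qed

lemma norm_diff_le_of_complex_grad_le: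
  assumes hol: "holomorphic_Cn f D" and "convex S" "S \<subseteq> D"
    and K: "\<And>y. y \<in> S \<Longrightarrow> norm (complex_grad f y) \<le> K"
    and "x \<in> S" "y \<in> S"
  shows "norm (f x - f y) \<le> K * norm (x - y)"
proof (rule differentiable_bound[OF \<open>convex S\<close>])
  fix s assume s: "s \<in> S"
  show "(f has_derivative pairing (complex_grad f s)) (at s within S)"
    using holomorphic_Cn_has_derivative[OF hol] s \<open>S \<subseteq> D\<close> by (blast intro: has_derivative_at_withinI)
  show "onorm (pairing (complex_grad f s)) \<le> K"
  proof (rule onorm_bound)
    show "0 \<le> K" using K[OF s] norm_ge_zero order_trans by blast
    show "norm (pairing (complex_grad f s) \<xi>) \<le> K * norm \<xi>" for \<xi>
      using norm_pairing_le mult_right_mono[OF K[OF s] norm_ge_zero] by (rule order_trans)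
  qed
qed (use assms in auto)

text \<open>Cauchy's inequality is applied to the difference of \<open>f\<close> along two parallel complex lines, through
\<open>w\<close> and through \<open>x\<close>. That difference is at most \<open>K\<close> times the distance of the lines, so its
derivative in the direction of the lines, which compares the two gradients, is small with it.\<close>

lemma complex_grad_oscillation:
  assumes hol: "holomorphic_Cn f D" and r: "0 < r" and sub: "ball w r \<subseteq> D"
    and K: "\<And>y. y \<in> ball w r \<Longrightarrow> norm (complex_grad f y) \<le> K"
    and x: "dist w x < r / 2"
  shows "norm (complex_grad f w) - norm (complex_grad f x) \<le> 2 * K * dist w x / r"
proof -
  obtain \<xi> where \<xi>: "norm \<xi> = 1" "norm (pairing (complex_grad f w) \<xi>) = norm (complex_grad f w)"
    using pairing_norming_vector by blast
  define h where "h \<zeta> = f (w + \<zeta> *s \<xi>) - f (x + \<zeta> *s \<xi>)" for \<zeta>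
  have in_ball: "w + \<zeta> *s \<xi> \<in> ball w r" "x + \<zeta> *s \<xi> \<in> ball w r" if "\<zeta> \<in> cball 0 (r/2)" for \<zeta>
  proof -
    have "norm (\<zeta> *s \<xi>) \<le> r / 2" using that \<xi> by (simp add: norm_vector_scalar_mult)
    moreover have "dist w (x + \<zeta> *s \<xi>) \<le> dist w x + norm (\<zeta> *s \<xi>)"
      using dist_triangle[of w "x + \<zeta> *s \<xi>" x] by (simp add: dist_norm)
    ultimately show "w + \<zeta> *s \<xi> \<in> ball w r" "x + \<zeta> *s \<xi> \<in> ball w r"
      using x r by (simp_all add: dist_norm)
  qed
  have deriv_h: "(h has_field_derivative pairing (complex_grad f (w + \<zeta> *s \<xi>)) \<xi> -
      pairing (complex_grad f (x + \<zeta> *s \<xi>)) \<xi>) (at \<zeta>)" if "\<zeta> \<in> cball 0 (r/2)" for \<zeta>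
    unfolding h_def
    by (intro DERIV_diff has_field_derivative_along_complex_line[OF hol])
       (use in_ball[OF that] sub in auto)
  have "norm ((deriv ^^ 1) h 0) \<le> fact 1 * (K * dist w x) / (r/2) ^ 1"
  proof (rule Cauchy_inequality)
    show "h holomorphic_on ball 0 (r/2)"
      unfolding holomorphic_on_open[OF open_ball] using deriv_h ball_subset_cball by blast
    show "continuous_on (cball 0 (r/2)) h"
      using deriv_h by (blast intro: continuous_at_imp_continuous_on DERIV_isCont)
    show "norm (h \<zeta>) \<le> K * dist w x" if "norm (0 - \<zeta>) = r/2" for \<zeta>
      using norm_diff_le_of_complex_grad_le[OF hol convex_ball sub K in_ball, of \<zeta> \<zeta>] that
      by (simp add: h_def dist_norm)
  qed (use r in auto)
  moreover have "deriv h 0 = pairing (complex_grad f w) \<xi> - pairing (complex_grad f x) \<xi>"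
    using deriv_h[of 0] r by (auto intro: DERIV_imp_deriv)
  ultimately have "norm (pairing (complex_grad f w) \<xi> - pairing (complex_grad f x) \<xi>) \<le> 2 * K * dist w x / r"
    by (simp add: mult_ac)
  moreover have "norm (pairing (complex_grad f x) \<xi>) \<le> norm (complex_grad f x)"
    using norm_pairing_le[of "complex_grad f x" \<xi>] \<xi> by simp
  ultimately show ?thesis
    using \<xi>(2) norm_triangle_ineq2[of "pairing (complex_grad f w) \<xi>" "pairing (complex_grad f x) \<xi>"] by linarith
qed

section \<open>Power means over balls\<close>

lemma set_integrable_lebesgue_ball:
  fixes h :: "'a::euclidean_space \<Rightarrow> real"
  assumes "continuous_on (cball z R) h"
  shows "set_integrable lebesgue (ball z R) h"
proof -
  have "integrable lborel (\<lambda>x. indicator (cball z R) x *\<^sub>R h x)"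
    by (rule borel_integrable_compact[OF compact_cball assms])
  then have "set_integrable lebesgue (cball z R) h"
    unfolding set_integrable_def by (subst integrable_completion) (auto dest: borel_measurable_integrable)
  then show ?thesis
    by (rule set_integrable_subset) auto
qed

lemma measure_lebesgue_ball:
  fixes z :: "'a::euclidean_space"
  assumes "0 \<le> r"
  shows "measure lebesgue (ball z r) = unit_ball_vol DIM('a) * r ^ DIM('a)"
  using content_ball[OF assms, of z] by simp

lemma powr_mean_le:
  fixes G :: "'a::euclidean_space \<Rightarrow> real"
  assumes "0 < p" "0 < R" "continuous_on (cball z R) G"
    and "\<And>x. x \<in> cball z R \<Longrightarrow> 0 \<le> G x \<and> G x \<le> K"
  shows "(1 / measure lebesgue (ball z R) * (LINT x:ball z R|lebesgue. G x powr p)) powr (1 / p) \<le> K"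
proof -
  have "0 \<le> K" using assms(4)[of z] \<open>0 < R\<close> by auto
  have pos: "0 < measure lebesgue (ball z R)"
    using \<open>0 < R\<close> by simp
  have "continuous_on (cball z R) (\<lambda>x. G x powr p)"
    by (intro continuous_on_powr' assms continuous_intros) (use assms in auto)
  then have int: "set_integrable lebesgue (ball z R) (\<lambda>x. G x powr p)"
    by (rule set_integrable_lebesgue_ball)
  have "(LINT x:ball z R|lebesgue. G x powr p) \<le> (LINT x:ball z R|lebesgue. K powr p)"
    by (rule set_integral_mono[OF int set_integrable_lebesgue_ball])
       (use assms in \<open>auto intro!: powr_mono2\<close>)
  also have "\<dots> = measure lebesgue (ball z R) * K powr p"
    by (simp add: set_integral_const set_lebesgue_integral_def)
  finally have "1 / measure lebesgue (ball z R) * (LINT x:ball z R|lebesgue. G x powr p) \<le> K powr p"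
    using pos by (simp add: field_simps)
  moreover have "0 \<le> (LINT x:ball z R|lebesgue. G x powr p)"
    by (simp add: set_lebesgue_integral_def)
  ultimately have "(1 / measure lebesgue (ball z R) * (LINT x:ball z R|lebesgue. G x powr p)) powr (1 / p)
      \<le> (K powr p) powr (1 / p)"
    using pos assms(1) by (intro powr_mono2) auto
  also have "\<dots> = K" using assms(1) \<open>0 \<le> K\<close> by (simp add: powr_powr)
  finally show ?thesis .
qed

text \<open>A weak sub-mean-value inequality for all exponents \<open>p > 0\<close>. The hypothesis \<open>osc\<close> is what Cauchy's
estimate provides for the modulus of a holomorphic gradient. The function
\<open>G(w) (R - \<bar>w - z\<bar>)\<^sup>a\<close> attains its maximum at some \<open>w\<close>; within half the distance of \<open>w\<close> from the
boundary of the ball the weight changes by at most the factor \<open>2\<^sup>a\<close>, so \<open>G \<le> 2\<^sup>a G(w)\<close> there,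
and \<open>osc\<close> gives \<open>G \<ge> G(w)/2\<close> on a ball \<open>B\<close> of comparable radius. The exponent \<open>a = dim / p\<close> makes
the loss in the volume of \<open>B\<close> match the weight exactly, which leaves a constant that depends on the
dimension and \<open>p\<close> only.\<close>

lemma centre_le_powr_mean:
  fixes G :: "'a::euclidean_space \<Rightarrow> real"
  assumes p: "0 < p" and R: "0 < R" and cont: "continuous_on (cball z R) G"
    and nonneg: "\<And>x. x \<in> cball z R \<Longrightarrow> 0 \<le> G x"
    and osc: "\<And>w x r K. \<lbrakk>0 < r; ball w r \<subseteq> ball z R; \<And>y. y \<in> ball w r \<Longrightarrow> G y \<le> K; dist w x < r / 2\<rbrakk>
      \<Longrightarrow> G w - G x \<le> 2 * K * dist w x / r"
  defines "a \<equiv> real DIM('a) / p"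
  shows "G z \<le> 2 * (8 * 2 powr a) powr a *
    (1 / measure lebesgue (ball z R) * (LINT x:ball z R|lebesgue. G x powr p)) powr (1 / p)"
    (is "_ \<le> _ * ?mean powr _")
proof (cases "G z = 0")
  case True
  then show ?thesis by simp
next
  case False
  let ?m = "DIM('a)"
  have Gz: "0 < G z" using False nonneg[of z] R by simp
  have "0 < a" using p by (simp add: a_def)
  define H where "H w = G w * (R - dist z w) powr a" for w
  have "continuous_on (cball z R) H"
    unfolding H_def
    by (intro continuous_on_mult cont continuous_on_powr' continuous_intros) (use \<open>0 < a\<close> in auto)
  then obtain w where w: "w \<in> cball z R" and max: "\<And>x. x \<in> cball z R \<Longrightarrow> H x \<le> H w"
    using continuous_attains_sup[of "cball z R" H] R by auto
  have Hz: "H z = G z * R powr a" by (simp add: H_def)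
  have "0 < H w" using max[of z] Hz Gz R by (smt (verit) centre_in_cball mult_pos_pos powr_gt_zero)
  then have "dist z w \<noteq> R" by (auto simp: H_def)
  \<comment> \<open>Half the distance from the maximum point to the boundary, so that the weight stays above \<open>r\<^sup>a\<close> on \<open>ball w r\<close>.\<close>
  define r where "r = (R - dist z w) / 2"
  have r: "0 < r" using w \<open>dist z w \<noteq> R\<close> by (simp add: r_def)
  have Gw: "0 < G w" using \<open>0 < H w\<close> nonneg[OF w] by (auto simp: H_def zero_less_mult_iff)
  have sub: "ball w r \<subseteq> ball z R"
  proof
    fix y assume "y \<in> ball w r"
    then have "dist z y < dist z w + r" using dist_triangle[of z y w] by simp
    also have "\<dots> \<le> R" using r unfolding r_def by argo
    finally show "y \<in> ball z R" by simp
  qed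
  have doubling: "G y \<le> 2 powr a * G w" if y: "y \<in> ball w r" for y
  proof -
    have "r \<le> R - dist z y" using y dist_triangle[of z y w] by (simp add: r_def)
    then have "G y * r powr a \<le> H y"
      unfolding H_def using r \<open>0 < a\<close> nonneg[of y] sub y by (intro mult_left_mono powr_mono2) auto
    also have "\<dots> \<le> H w" using max[of y] sub y by auto
    also have "2 * r = R - dist z w" by (simp add: r_def)
    then have "H w = G w * (2 * r) powr a" by (simp add: H_def)
    also have "\<dots> = (2 powr a * G w) * r powr a" using r by (simp add: powr_mult)
    finally show ?thesis using r by simp
  qed
  \<comment> \<open>The radius at which \<open>osc\<close>, with \<open>K = 2\<^sup>a G(w)\<close>, allows a drop of exactly \<open>G(w)/2\<close>.\<close>
  define \<rho> where "\<rho> = r / (4 * 2 powr a)"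
  have a1: "1 \<le> 2 powr a" using \<open>0 < a\<close> by (simp add: ge_one_powr_ge_zero)
  have \<rho>: "0 < \<rho>" "\<rho> < r / 2" "\<rho> < r" using r a1 by (simp_all add: \<rho>_def field_simps)
  have half: "G w / 2 \<le> G x" if x: "x \<in> ball w \<rho>" for x
  proof -
    have "G w - G x \<le> 2 * (2 powr a * G w) * dist w x / r"
      by (rule osc[OF r sub doubling]) (use x \<rho> in auto)
    also have "\<dots> \<le> 2 * (2 powr a * G w) * \<rho> / r"
      using x Gw r by (intro divide_right_mono mult_left_mono) auto
    also have "\<dots> = G w / 2" using r by (simp add: \<rho>_def)
    finally show ?thesis by simp
  qed
  have sub\<rho>: "ball w \<rho> \<subseteq> ball z R" using sub \<rho> by force
  have contp: "continuous_on (cball z R) (\<lambda>x. G x powr p)"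
    by (intro continuous_on_powr' cont continuous_intros) (use nonneg p in auto)
  then have int: "set_integrable lebesgue (ball z R) (\<lambda>x. G x powr p)"
    by (rule set_integrable_lebesgue_ball)
  have "measure lebesgue (ball w \<rho>) * (G w / 2) powr p = (LINT x:ball w \<rho>|lebesgue. (G w / 2) powr p)"
    by (simp add: set_lebesgue_integral_def)
  also have "\<dots> \<le> (LINT x:ball w \<rho>|lebesgue. G x powr p)"
  proof (rule set_integral_mono)
    show "set_integrable lebesgue (ball w \<rho>) (\<lambda>x. (G w / 2) powr p)"
      by (rule set_integrable_lebesgue_ball) simp
    show "set_integrable lebesgue (ball w \<rho>) (\<lambda>x. G x powr p)"
      by (rule set_integrable_subset[OF int]) (use sub\<rho> in auto)
    show "(G w / 2) powr p \<le> G x powr p" if "x \<in> ball w \<rho>" for x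
      using half[OF that] Gw p by (intro powr_mono2) auto
  qed
  also have "\<dots> \<le> (LINT x:ball z R|lebesgue. G x powr p)"
    unfolding set_lebesgue_integral_def
  proof (rule integral_mono)
    show "integrable lebesgue (\<lambda>x. indicat_real (ball w \<rho>) x *\<^sub>R G x powr p)"
      using set_integrable_subset[OF int, of "ball w \<rho>"] sub\<rho> by (simp add: set_integrable_def)
    show "integrable lebesgue (\<lambda>x. indicat_real (ball z R) x *\<^sub>R G x powr p)"
      using int by (simp add: set_integrable_def)
    show "indicat_real (ball w \<rho>) x *\<^sub>R G x powr p \<le> indicat_real (ball z R) x *\<^sub>R G x powr p" for x
      using sub\<rho> by (auto simp: indicator_def)
  qed
  finally have "measure lebesgue (ball w \<rho>) * (G w / 2) powr p / measure lebesgue (ball z R) \<le> ?mean"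
    by (simp add: divide_right_mono)
  moreover have "measure lebesgue (ball w \<rho>) * (G w / 2) powr p / measure lebesgue (ball z R)
      = (\<rho> / R) ^ ?m * (G w / 2) powr p"
  proof -
    have "unit_ball_vol (real ?m) \<noteq> 0" by (metis unit_ball_vol_pos less_irrefl of_nat_0_le_iff)
    then show ?thesis
      unfolding measure_lebesgue_ball[OF less_imp_le[OF \<rho>(1)]] measure_lebesgue_ball[OF less_imp_le[OF R]]
      by (simp add: power_divide)
  qed
  ultimately have "((\<rho> / R) ^ ?m * (G w / 2) powr p) powr (1 / p) \<le> ?mean powr (1 / p)"
    using p by (intro powr_mono2) (auto simp: R \<rho> less_imp_le)
  moreover have "((\<rho> / R) ^ ?m * (G w / 2) powr p) powr (1 / p) = (\<rho> / R) powr a * (G w / 2)"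
  proof -
    have "(\<rho> / R) ^ ?m = (\<rho> / R) powr real ?m"
      using \<rho> R by (simp add: powr_realpow)
    then show ?thesis
      using \<rho> R Gw p by (simp add: powr_mult powr_powr a_def)
  qed
  moreover have "G z \<le> (2 * r / R) powr a * G w"
  proof -
    have "2 * r = R - dist z w" by (simp add: r_def)
    then have "G z * R powr a \<le> G w * (2 * r) powr a"
      using max[of z] R by (simp add: Hz) (simp add: H_def)
    then show ?thesis using R r by (simp add: powr_divide field_simps)
  qed
  moreover have "(2 * r / R) powr a * G w = 2 * (8 * 2 powr a) powr a * ((\<rho> / R) powr a * (G w / 2))"
  proof -
    have eq: "2 * r / R = (8 * 2 powr a) * (\<rho> / R)"
      using R by (simp add: \<rho>_def field_simps)
    have "(2 * r / R) powr a = (8 * 2 powr a) powr a * (\<rho> / R) powr a"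
      unfolding eq by (rule powr_mult)
    then show ?thesis by simp
  qed
  ultimately show ?thesis
    by (smt (verit) mult_left_mono powr_ge_zero)
qed

section \<open>Functions whose oscillation controls the derivative\<close>

text \<open>The second condition says that the values \<open>b\<close> at which \<open>\<phi>\<close> is close to \<open>\<phi> a\<close> lie in a half-plane
whose boundary passes close to \<open>a\<close>: a one-sided bound in one direction \<open>c\<close>, which may depend on \<open>a\<close>,
is what the Borel-Caratheodory estimate needs.\<close>

definition directional_gauge :: "(complex \<Rightarrow> real) \<Rightarrow> bool" where
  "directional_gauge \<phi> \<longleftrightarrow> (\<forall>a b. \<bar>\<phi> a - \<phi> b\<bar> \<le> norm (a - b)) \<and>
     (\<forall>a. \<exists>c. norm c = 1 \<and> (\<forall>b. Re (c * (b - a)) \<le> \<bar>\<phi> b - \<phi> a\<bar>))"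

lemma directional_gauge_Re: "directional_gauge Re"
  unfolding directional_gauge_def
  by (intro conjI allI exI[of _ 1]) (simp_all add: abs_Re_le_cmod flip: minus_complex.sel)

lemma directional_gauge_Im: "directional_gauge Im"
  unfolding directional_gauge_def
  by (intro conjI allI exI[of _ "-\<i>"]) (simp_all add: abs_Im_le_cmod flip: minus_complex.sel)

text \<open>With the sign of \<open>Re a\<close> as \<open>c\<close>, one has \<open>Re (c b) \<le> \<bar>Re b\<bar>\<close> with equality at \<open>a\<close>, so the two
directions \<open>1\<close> and \<open>-1\<close> suffice whether or not the real part changes sign.\<close>

lemma directional_gauge_abs_Re: "directional_gauge (\<lambda>a. \<bar>Re a\<bar>)"
  unfolding directional_gauge_def
proof (intro conjI allI)
  show "\<bar>\<bar>Re a\<bar> - \<bar>Re b\<bar>\<bar> \<le> norm (a - b)" for a b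
    using abs_Re_le_cmod[of "a - b"] by simp
  show "\<exists>c. norm c = 1 \<and> (\<forall>b. Re (c * (b - a)) \<le> \<bar>\<bar>Re b\<bar> - \<bar>Re a\<bar>\<bar>)" for a
    by (rule exI[of _ "if Re a \<ge> 0 then 1 else -1"]) auto
qed

lemma directional_gauge_abs_Im: "directional_gauge (\<lambda>a. \<bar>Im a\<bar>)"
  unfolding directional_gauge_def
proof (intro conjI allI)
  show "\<bar>\<bar>Im a\<bar> - \<bar>Im b\<bar>\<bar> \<le> norm (a - b)" for a b
    using abs_Im_le_cmod[of "a - b"] by simp
  show "\<exists>c. norm c = 1 \<and> (\<forall>b. Re (c * (b - a)) \<le> \<bar>\<bar>Im b\<bar> - \<bar>Im a\<bar>\<bar>)" for a
    by (rule exI[of _ "if Im a \<ge> 0 then -\<i> else \<i>"]) auto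
qed

text \<open>The direction is that of \<open>a\<close> itself: rotated so that \<open>c a = \<bar>a\<bar>\<close>, one has \<open>Re (c b) \<le> \<bar>b\<bar>\<close> with
equality at \<open>a\<close>.\<close>

lemma directional_gauge_norm: "directional_gauge norm"
  unfolding directional_gauge_def
proof (intro conjI allI)
  show "\<bar>norm a - norm b\<bar> \<le> norm (a - b)" for a b :: complex
    by (rule norm_triangle_ineq3)
  fix a :: complex
  obtain c where c: "norm c = 1" "c * a = of_real (norm a)"
  proof (cases "a = 0")
    case True
    then show thesis using that[of 1] by simp
  next
    case False
    then show thesis using that[of "cnj a / of_real (norm a)"]
      by (simp add: norm_divide complex_norm_square[symmetric] power2_eq_square mult.commute)
  qed
  have "Re (c * (b - a)) \<le> \<bar>norm b - norm a\<bar>" for b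
    using complex_Re_le_cmod[of "c * b"] c by (simp add: right_diff_distrib norm_mult)
  with c show "\<exists>c. norm c = 1 \<and> (\<forall>b. Re (c * (b - a)) \<le> \<bar>norm b - norm a\<bar>)"
    by blast
qed

section \<open>Lipschitz classes and the growth of the gradient\<close>

text \<open>The growth condition at the centre of the argument; it is applied to the norms of \<open>f'\<close>, \<open>\<nabla>u\<close>
and \<open>\<nabla>v\<close> and to their power means.\<close>

definition growth_bounded :: "(real \<Rightarrow> real) \<Rightarrow> 'a::metric_space set \<Rightarrow> ('a \<Rightarrow> real) \<Rightarrow> bool" where
  "growth_bounded \<psi> D g \<longleftrightarrow> (\<exists>C>0. \<forall>z\<in>D. g z \<le> C * (\<psi> (bdist D z) / bdist D z))"

lemma Lip_cong: "(\<And>z. z \<in> D \<Longrightarrow> g z = h z) \<Longrightarrow> g \<in> Lip \<psi> D \<longleftrightarrow> h \<in> Lip \<psi> D"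
  by (simp add: Lip_def)

lemma Lip_gauge:
  assumes "f \<in> Lip \<psi> D" "directional_gauge \<phi>"
  shows "(\<lambda>z. \<phi> (f z)) \<in> Lip \<psi> D"
  using assms unfolding Lip_def directional_gauge_def real_norm_def mem_Collect_eq by (meson order_trans)

text \<open>Both Lipschitz conditions, on \<open>D\<close> and between \<open>D\<close> and its boundary, enter only through the
oscillation over the ball of half the distance to the boundary.\<close>

lemma growth_bounded_complex_grad_if_gauge_oscillation:
  assumes proper: "proper_domain D" and hol: "holomorphic_Cn f D"
    and gauge: "directional_gauge \<phi>" and "0 < C"
    and osc: "\<And>z w. \<lbrakk>z \<in> D; w \<in> cball z (bdist D z / 2)\<rbrakk> \<Longrightarrow> \<bar>\<phi> (f w) - \<phi> (f z)\<bar> \<le> C * \<psi> (bdist D z)"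
  shows "growth_bounded \<psi> D (\<lambda>z. norm (complex_grad f z))"
  unfolding growth_bounded_def
proof (intro exI[of _ "4 * C"] conjI ballI)
  show "0 < 4 * C" using assms by simp
  fix z assume z: "z \<in> D"
  have d: "0 < bdist D z" by (rule bdist_pos[OF proper z])
  obtain c where c: "norm c = 1" "\<And>b. Re (c * (b - f z)) \<le> \<bar>\<phi> b - \<phi> (f z)\<bar>"
    using gauge unfolding directional_gauge_def by meson
  have "norm (complex_grad f z) \<le> 2 * (C * \<psi> (bdist D z)) / (bdist D z / 2)"
    by (rule norm_complex_grad_le_of_Re_le[OF hol ball_bdist_subset[OF z] _ _ c(1)])
       (use d c(2) osc[OF z] in \<open>auto intro: order_trans\<close>)
  then show "norm (complex_grad f z) \<le> 4 * C * (\<psi> (bdist D z) / bdist D z)"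
    by (simp add: mult.commute mult.left_commute)
qed

lemma growth_bounded_complex_grad_if_gauge_Lip:
  assumes "proper_domain D" "majorant \<psi>" "holomorphic_Cn f D" "directional_gauge \<phi>"
    and "(\<lambda>z. \<phi> (f z)) \<in> Lip \<psi> D"
  shows "growth_bounded \<psi> D (\<lambda>z. norm (complex_grad f z))"
proof -
  obtain C where C: "0 < C" "\<And>z w. \<lbrakk>z \<in> D; w \<in> D\<rbrakk> \<Longrightarrow> \<bar>\<phi> (f z) - \<phi> (f w)\<bar> \<le> C * \<psi> (norm (z - w))"
    using assms(5) by (auto simp: Lip_def)
  show ?thesis
  proof (rule growth_bounded_complex_grad_if_gauge_oscillation[OF assms(1,3,4) C(1)])
    fix z w assume z: "z \<in> D" and w: "w \<in> cball z (bdist D z / 2)"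
    have d: "0 < bdist D z" using bdist_pos assms z by blast
    then have "w \<in> D" using w by (intro subsetD[OF ball_bdist_subset[OF z]]) auto
    then have "\<bar>\<phi> (f w) - \<phi> (f z)\<bar> \<le> C * \<psi> (norm (w - z))" by (rule C(2)[OF _ z])
    also have "\<psi> (norm (w - z)) \<le> \<psi> (bdist D z)"
      using assms(2) w d unfolding majorant_def mono_on_def by (auto simp: dist_norm norm_minus_commute)
    finally show "\<bar>\<phi> (f w) - \<phi> (f z)\<bar> \<le> C * \<psi> (bdist D z)" using C(1) by simp
  qed
qed

text \<open>For \<open>w\<close> in the ball of radius \<open>d(z)/2\<close>, both \<open>w\<close> and \<open>z\<close> are compared with a boundary point \<open>b\<close> nearest
to \<open>z\<close>. The distance from \<open>w\<close> to \<open>b\<close> is at most \<open>3/2 d(z)\<close>, so the oscillation is at most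
\<open>(3/2 + 1) C \<psi>(d(z))\<close>.\<close>

lemma growth_bounded_complex_grad_if_gauge_Lip2:
  assumes "proper_domain D" "majorant \<psi>" "holomorphic_Cn f D" "directional_gauge \<phi>"
    and "F \<in> Lip2 \<psi> D (frontier D)" "\<And>z. z \<in> D \<Longrightarrow> F z = \<phi> (f z)"
  shows "growth_bounded \<psi> D (\<lambda>z. norm (complex_grad f z))"
proof -
  obtain C where C: "0 < C"
    "\<And>z w. \<lbrakk>z \<in> D; w \<in> frontier D\<rbrakk> \<Longrightarrow> \<bar>F z - F w\<bar> \<le> C * \<psi> (dist z w)"
    using assms(5) by (auto simp: Lip2_def dist_norm)
  show ?thesis
  proof (rule growth_bounded_complex_grad_if_gauge_oscillation[OF assms(1,3,4), of "5/2 * C"])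
    fix z w assume z: "z \<in> D" and w: "w \<in> cball z (bdist D z / 2)"
    let ?d = "bdist D z"
    have d: "0 < ?d" using bdist_pos assms z by blast
    then have wD: "w \<in> D" using w by (intro subsetD[OF ball_bdist_subset[OF z]]) auto
    obtain b where b: "b \<in> frontier D" "dist z b = ?d"
      using infdist_attains_inf[OF frontier_closed frontier_proper_domain_nonempty[OF assms(1)], of z]
      unfolding bdist_def by metis
    have "dist w b \<le> 3/2 * ?d"
      using dist_triangle[of w b z] w b by (simp add: dist_commute)
    then have "\<psi> (dist w b) \<le> \<psi> (3/2 * ?d)"
      using assms(2) d unfolding majorant_def mono_on_def by auto
    also have "\<dots> \<le> 3/2 * \<psi> ?d"
      using majorant_scale_le[OF assms(2), of "3/2" ?d] d by simp
    finally have "C * \<psi> (dist w b) \<le> C * (3/2 * \<psi> ?d)"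
      using C(1) by simp
    then have "\<bar>F w - F b\<bar> \<le> 3/2 * (C * \<psi> ?d)" "\<bar>F z - F b\<bar> \<le> C * \<psi> ?d"
      using C(2)[OF wD b(1)] C(2)[OF z b(1)] b(2) by auto
    then have "\<bar>F w - F z\<bar> \<le> 5/2 * (C * \<psi> ?d)" by argo
    then show "\<bar>\<phi> (f w) - \<phi> (f z)\<bar> \<le> 5/2 * C * \<psi> ?d"
      using assms(6) z wD by (simp add: mult.assoc)
  qed (use C in auto)
qed

text \<open>If \<open>t = \<bar>z - w\<bar> < d(z)/2\<close>, then all points of the ball of radius \<open>d(z)/2\<close> around \<open>z\<close> have boundary
distance at least \<open>t\<close>, and monotonicity of \<open>\<psi>(t)/t\<close> replaces their boundary distance by \<open>t\<close>.
This gives the local Lipschitz condition, which on an extension domain is the global one.\<close>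

lemma Lip_if_growth_bounded_complex_grad:
  assumes ext: "extension_domain \<psi> D" and maj: "majorant \<psi>" and hol: "holomorphic_Cn f D"
    and "growth_bounded \<psi> D (\<lambda>z. norm (complex_grad f z))"
  shows "f \<in> Lip \<psi> D"
proof -
  have proper: "proper_domain D" using ext by (simp add: extension_domain_def)
  have anti: "antimono_on {0<..} (\<lambda>t. \<psi> t / t)" and nonneg: "\<And>t. 0 \<le> t \<Longrightarrow> 0 \<le> \<psi> t"
    using maj by (auto simp: majorant_def)
  obtain C where C: "0 < C"
    "\<And>z. z \<in> D \<Longrightarrow> norm (complex_grad f z) \<le> C * (\<psi> (bdist D z) / bdist D z)"
    using assms(4) unfolding growth_bounded_def by blast
  have "norm (f z - f w) \<le> C * \<psi> (norm (z - w))"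
    if z: "z \<in> D" and w: "norm (z - w) < bdist D z / 2" for z w
  proof (cases "z = w")
    case True
    then show ?thesis using C(1) nonneg[of 0] by simp
  next
    case False
    define t where "t = norm (z - w)"
    have t: "0 < t" "t < bdist D z / 2" using False w by (simp_all add: t_def)
    have sub: "ball z (bdist D z / 2) \<subseteq> D"
      using ball_bdist_subset[OF z] t by (auto intro!: subsetD[OF ball_bdist_subset[OF z]])
    have grad_le: "norm (complex_grad f x) \<le> C * (\<psi> t / t)" if x: "x \<in> ball z (bdist D z / 2)" for x
    proof -
      have "t \<le> bdist D x" using bdist_triangle[of D z x] x t by simp
      then have "\<psi> (bdist D x) / bdist D x \<le> \<psi> t / t"
        by (intro monotone_onD[OF anti]) (use t in auto)
      then show ?thesis
        using C(2)[of x] x sub mult_left_mono[of "\<psi> (bdist D x) / bdist D x" "\<psi> t / t" C] C(1)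
        by fastforce
    qed
    have "norm (f z - f w) \<le> C * (\<psi> t / t) * norm (z - w)"
      by (rule norm_diff_le_of_complex_grad_le[OF hol convex_ball sub grad_le])
         (use t w in \<open>auto simp: dist_norm\<close>)
    also have "\<dots> = C * \<psi> t" using t by (simp add: t_def)
    finally show ?thesis by (simp add: t_def)
  qed
  with C(1) have "f \<in> loc_Lip \<psi> D" unfolding loc_Lip_def by blast
  with ext show ?thesis by (simp add: extension_domain_def)
qed

text \<open>Since \<open>\<psi>\<close> is continuous with \<open>\<psi> 0 = 0\<close>, a function in the Lipschitz class is uniformly continuous
and extends continuously to the closure; the estimate passes to the limit by continuity of \<open>\<psi>\<close>.\<close>

lemma Lip_extends_to_Lip2:
  fixes g :: "'a::real_normed_vector \<Rightarrow> 'b::banach"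
  assumes maj: "majorant \<psi>" and "g \<in> Lip \<psi> D"
  shows "\<exists>F \<in> Lip2 \<psi> D (frontier D). \<forall>z\<in>D. F z = g z"
proof -
  obtain C where C: "0 < C" "\<And>z w. \<lbrakk>z \<in> D; w \<in> D\<rbrakk> \<Longrightarrow> norm (g z - g w) \<le> C * \<psi> (norm (z - w))"
    using assms(2) unfolding Lip_def by blast
  have cont: "continuous_on {0..} \<psi>" and \<psi>0: "\<psi> 0 = 0" and nonneg: "\<And>t. 0 \<le> t \<Longrightarrow> 0 \<le> \<psi> t"
    using maj by (auto simp: majorant_def)
  have "uniformly_continuous_on D g"
    unfolding uniformly_continuous_on_def
  proof (intro allI impI)
    fix e :: real assume "0 < e"
    then have "0 < e / C" using C by simp
    with cont obtain \<delta> where "0 < \<delta>" and \<delta>: "\<And>t. \<lbrakk>0 \<le> t; dist t 0 < \<delta>\<rbrakk> \<Longrightarrow> dist (\<psi> t) (\<psi> 0) < e / C"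
      unfolding continuous_on_iff by (metis atLeast_iff order_refl)
    have small: "\<psi> t < e / C" if "0 \<le> t" "t < \<delta>" for t
      using \<delta>[of t] that nonneg[of t] \<psi>0 by (simp add: dist_real_def)
    show "\<exists>d>0. \<forall>x\<in>D. \<forall>x'\<in>D. dist x' x < d \<longrightarrow> dist (g x') (g x) < e"
    proof (intro exI[of _ \<delta>] conjI ballI impI \<open>0 < \<delta>\<close>)
      fix x x' assume x: "x \<in> D" "x' \<in> D" "dist x' x < \<delta>"
      have "dist (g x') (g x) \<le> C * \<psi> (norm (x' - x))" using C(2)[OF x(2,1)] by (simp add: dist_norm)
      also have "\<dots> < C * (e / C)" using small[of "norm (x' - x)"] x C(1) by (simp add: dist_norm mult_less_cancel_left_pos
          del: times_divide_eq_right)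
      also have "\<dots> = e" using C(1) by simp
      finally show "dist (g x') (g x) < e" .
    qed
  qed
  then obtain F where F: "uniformly_continuous_on (closure D) F" "\<And>x. x \<in> D \<Longrightarrow> g x = F x"
    using uniformly_continuous_on_extension_on_closure by metis
  have contF: "continuous_on (closure D) F"
    using F(1) by (rule uniformly_continuous_imp_continuous)
  have "norm (F z - F w) \<le> C * \<psi> (norm (z - w))" if z: "z \<in> D" and w: "w \<in> frontier D" for z w
  proof -
    have "w \<in> closure D" using w by (simp add: frontier_def)
    then obtain x where x: "\<And>n. x n \<in> D" "x \<longlonglongrightarrow> w"
      by (auto simp: closure_sequential)
    have "(\<lambda>n. F (x n)) \<longlonglongrightarrow> F w"
      by (rule continuous_on_tendsto_compose[OF contF x(2) \<open>w \<in> closure D\<close>])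
         (simp add: x(1) subsetD[OF closure_subset])
    then have lim1: "(\<lambda>n. norm (F z - F (x n))) \<longlonglongrightarrow> norm (F z - F w)"
      by (intro tendsto_intros)
    have "(\<lambda>n. \<psi> (norm (z - x n))) \<longlonglongrightarrow> \<psi> (norm (z - w))"
      by (intro continuous_on_tendsto_compose[OF cont] tendsto_intros x) auto
    then have lim2: "(\<lambda>n. C * \<psi> (norm (z - x n))) \<longlonglongrightarrow> C * \<psi> (norm (z - w))"
      by (intro tendsto_intros)
    show ?thesis
      by (rule LIMSEQ_le[OF lim1 lim2]) (use C(2)[OF z x(1)] F(2) z x(1) in auto)
  qed
  moreover have "D \<union> frontier D = closure D"
    by (simp add: closure_Un_frontier)
  ultimately have "F \<in> Lip2 \<psi> D (frontier D)"
    using C(1) contF unfolding Lip2_def by auto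
  then show ?thesis using F(2) by force
qed

text \<open>The closed balls of radius \<open>d(z)/2\<close> are compact subsets of \<open>D\<close>. On them the boundary distance is at
least \<open>d(z)/2\<close>, which gives one direction; the maximum argument for power means, fed with Cauchy's
estimate for the gradient, gives the other with a constant independent of \<open>z\<close>.\<close>

lemma growth_bounded_grad_mean_iff:
  assumes proper: "proper_domain D" and maj: "majorant \<psi>" and hol: "holomorphic_Cn f D"
    and C1: "C1_on D u" and p: "0 < p"
    and grad_eq: "\<And>z. z \<in> D \<Longrightarrow> norm (grad u z) = norm (complex_grad f z)"
  shows "growth_bounded \<psi> D (grad_mean D u p) \<longleftrightarrow> growth_bounded \<psi> D (\<lambda>z. norm (complex_grad f z))"
    (is "?mean \<longleftrightarrow> ?grad")
proof
  let ?G = "\<lambda>z. norm (grad u z)"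
  have pos: "0 < bdist D z / 2" if "z \<in> D" for z using bdist_pos[OF proper that] by simp
  have sub: "cball z (bdist D z / 2) \<subseteq> D" if "z \<in> D" for z
    using ball_bdist_subset[OF that] pos[OF that] by (force intro!: subsetD[OF ball_bdist_subset[OF that]])
  have cont: "continuous_on (cball z (bdist D z / 2)) ?G" if "z \<in> D" for z
    by (intro continuous_on_norm continuous_on_subset[OF continuous_on_grad[OF C1] sub[OF that]])
  {
    assume ?grad
    then obtain C where C: "0 < C" "\<And>z. z \<in> D \<Longrightarrow> ?G z \<le> C * (\<psi> (bdist D z) / bdist D z)"
      using grad_eq unfolding growth_bounded_def by force
    have "grad_mean D u p z \<le> 2 * C * (\<psi> (bdist D z) / bdist D z)" if z: "z \<in> D" for z
      unfolding grad_mean_def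
    proof (rule powr_mean_le[OF p pos[OF z] cont[OF z]])
      fix x assume x: "x \<in> cball z (bdist D z / 2)"
      have "?G x \<le> C * (\<psi> (bdist D x) / bdist D x)" using C(2) x sub[OF z] by blast
      also have "\<psi> (bdist D x) / bdist D x \<le> 2 * (\<psi> (bdist D z) / bdist D z)"
        by (rule majorant_quotient_half_le[OF maj]) (use bdist_triangle[of D z x] x pos[OF z] in auto)
      finally show "0 \<le> ?G x \<and> ?G x \<le> 2 * C * (\<psi> (bdist D z) / bdist D z)"
        using C(1) by (simp add: mult_left_mono mult.assoc mult.left_commute)
    qed
    with C(1) show ?mean unfolding growth_bounded_def by (intro exI[of _ "2 * C"]) auto
  }
  {
    assume ?mean
    then obtain C where C: "0 < C" "\<And>z. z \<in> D \<Longrightarrow> grad_mean D u p z \<le> C * (\<psi> (bdist D z) / bdist D z)"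
      unfolding growth_bounded_def by blast
    define a where "a = real DIM(complex ^ 'a) / p"
    define A where "A = 2 * (8 * 2 powr a) powr a"
    have "0 < A" by (simp add: A_def)
    have "norm (complex_grad f z) \<le> A * C * (\<psi> (bdist D z) / bdist D z)" if z: "z \<in> D" for z
    proof -
      have "?G z \<le> A * grad_mean D u p z"
        unfolding A_def a_def grad_mean_def
      proof (rule centre_le_powr_mean[OF p pos[OF z] cont[OF z]])
        fix w x r K
        assume r: "0 < r" and w: "ball w r \<subseteq> ball z (bdist D z / 2)"
          and K: "\<And>y. y \<in> ball w r \<Longrightarrow> ?G y \<le> K" and x: "dist w x < r / 2"
        have sub_w: "ball w r \<subseteq> D" using w sub[OF z] by (meson ball_subset_cball order_trans)
        have "norm (complex_grad f w) - norm (complex_grad f x) \<le> 2 * K * dist w x / r"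
          by (rule complex_grad_oscillation[OF hol r sub_w _ x]) (use K grad_eq sub_w in force)
        then show "?G w - ?G x \<le> 2 * K * dist w x / r"
          using grad_eq[of w] grad_eq[of x] sub_w r x by (simp add: subset_iff)
      qed simp
      also have "\<dots> \<le> A * (C * (\<psi> (bdist D z) / bdist D z))"
        using C(2)[OF z] \<open>0 < A\<close> by (intro mult_left_mono) auto
      finally show ?thesis using grad_eq[OF z] by simp
    qed
    with C(1) \<open>0 < A\<close> show ?grad unfolding growth_bounded_def by (intro exI[of _ "A * C"]) auto
  }
qed

lemma admissible_exponent_pos:
  assumes "admissible_exponent n p" "1 \<le> n"
  shows "0 < p"
proof (cases "n = 1")
  case False
  then have "0 < (2 * real n - 2) / (2 * real n - 1)" using assms(2) by auto
  moreover have "(2 * real n - 2) / (2 * real n - 1) \<le> p"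
    using assms False by (simp add: admissible_exponent_def)
  ultimately show ?thesis by linarith
qed (use assms in \<open>simp add: admissible_exponent_def\<close>)

section \<open>The equivalences\<close>

theorem theorem2p12:
  fixes \<psi> :: "real \<Rightarrow> real"
    and E :: "(complex ^ 'n) set"
    and f :: "complex ^ 'n \<Rightarrow> complex"
    and u v :: "complex ^ 'n \<Rightarrow> real"
    and p q :: real
  assumes "fast_majorant \<psi>"
    and "extension_domain \<psi> E"
    and "holomorphic_Cn f E"
    and "\<forall>z\<in>E. f z = complex_of_real (u z) + \<i> * complex_of_real (v z)"
    and "pluriharmonic_on E u"
    and "pluriharmonic_on E v"
    and "admissible_exponent CARD('n) p"
    and "admissible_exponent CARD('n) q"
  defines "C1 \<equiv> u \<in> Lip \<psi> E"
    and "C2 \<equiv> \<exists>C>0. \<forall>z\<in>E. norm (grad u z) \<le> C * (\<psi> (bdist E z) / bdist E z)"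
    and "C3 \<equiv> (\<lambda>z. \<bar>u z\<bar>) \<in> Lip \<psi> E"
    and "C4 \<equiv> \<exists>C>0. \<forall>z\<in>E. grad_mean E u p z \<le> C * (\<psi> (bdist E z) / bdist E z)"
    and "C5 \<equiv> v \<in> Lip \<psi> E"
    and "C6 \<equiv> \<exists>C>0. \<forall>z\<in>E. norm (grad v z) \<le> C * (\<psi> (bdist E z) / bdist E z)"
    and "C7 \<equiv> (\<lambda>z. \<bar>v z\<bar>) \<in> Lip \<psi> E"
    and "C8 \<equiv> \<exists>C>0. \<forall>z\<in>E. grad_mean E v q z \<le> C * (\<psi> (bdist E z) / bdist E z)"
    and "C9 \<equiv> f \<in> Lip \<psi> E"
    and "C10 \<equiv> (\<lambda>z. norm (f z)) \<in> Lip \<psi> E"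
    and "C11 \<equiv> \<exists>F \<in> Lip2 \<psi> E (frontier E). \<forall>z\<in>E. F z = norm (f z)"
  shows "(C1 \<longleftrightarrow> C2) \<and> (C1 \<longleftrightarrow> C3) \<and> (C1 \<longleftrightarrow> C4) \<and> (C1 \<longleftrightarrow> C5) \<and> (C1 \<longleftrightarrow> C6) \<and>
         (C1 \<longleftrightarrow> C7) \<and> (C1 \<longleftrightarrow> C8) \<and> (C1 \<longleftrightarrow> C9) \<and> (C1 \<longleftrightarrow> C10) \<and> (C1 \<longleftrightarrow> C11)"
proof -
  let ?G = "growth_bounded \<psi> E (\<lambda>z. norm (complex_grad f z))"
  have maj: "majorant \<psi>" using assms(1) by (simp add: fast_majorant_def)
  have proper: "proper_domain E" using assms(2) by (simp add: extension_domain_def)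
  then have "open E" by (simp add: proper_domain_def)
  have uv: "u z = Re (f z)" "v z = Im (f z)" if "z \<in> E" for z
    using assms(4) that by simp_all
  have C1_uv: "C1_on E u" "C1_on E v"
    using assms(5,6) by (simp_all add: pluriharmonic_on_def C2_on_def)
  have exps: "0 < p" "0 < q"
    using assms(7,8) by (auto intro: admissible_exponent_pos[of "CARD('n)"] simp: Suc_leI)
  have grad_u: "norm (grad u z) = norm (complex_grad f z)" if "z \<in> E" for z
    by (rule norm_grad_Re[OF assms(3) \<open>open E\<close> that uv(1)])
  have grad_v: "norm (grad v z) = norm (complex_grad f z)" if "z \<in> E" for z
    by (rule norm_grad_Im[OF assms(3) \<open>open E\<close> that uv(2)])
  have Lip_f: "C9" if ?G
    unfolding C9_def by (rule Lip_if_growth_bounded_complex_grad[OF assms(2) maj assms(3) that])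
  have gauge: "(\<lambda>z. \<phi> (f z)) \<in> Lip \<psi> E \<longleftrightarrow> ?G" if "directional_gauge \<phi>" for \<phi>
    using growth_bounded_complex_grad_if_gauge_Lip[OF proper maj assms(3) that]
      Lip_gauge[OF _ that] Lip_f unfolding C9_def by blast
  have "C9 \<longleftrightarrow> ?G"
    using Lip_f Lip_gauge[OF _ directional_gauge_norm] gauge[OF directional_gauge_norm]
    unfolding C9_def by blast
  moreover have "C1 \<longleftrightarrow> ?G" "C5 \<longleftrightarrow> ?G"
    unfolding C1_def C5_def
    using gauge[OF directional_gauge_Re] gauge[OF directional_gauge_Im] uv
    by (simp_all cong: Lip_cong)
  moreover have "C3 \<longleftrightarrow> ?G" "C7 \<longleftrightarrow> ?G"
    unfolding C3_def C7_def
    using gauge[OF directional_gauge_abs_Re] gauge[OF directional_gauge_abs_Im] uv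
    by (simp_all cong: Lip_cong)
  moreover have "C10 \<longleftrightarrow> ?G"
    unfolding C10_def by (rule gauge[OF directional_gauge_norm])
  moreover have "C11 \<longleftrightarrow> ?G"
    unfolding C11_def
    using growth_bounded_complex_grad_if_gauge_Lip2[OF proper maj assms(3) directional_gauge_norm]
      Lip_extends_to_Lip2[OF maj] gauge[OF directional_gauge_norm] by blast
  moreover have "C2 \<longleftrightarrow> ?G" "C6 \<longleftrightarrow> ?G"
    unfolding C2_def C6_def growth_bounded_def using grad_u grad_v by simp_all
  moreover have "C4 \<longleftrightarrow> ?G" "C8 \<longleftrightarrow> ?G"
    using growth_bounded_grad_mean_iff[OF proper maj assms(3) C1_uv(1) exps(1) grad_u]
      growth_bounded_grad_mean_iff[OF proper maj assms(3) C1_uv(2) exps(2) grad_v]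
    unfolding C4_def C8_def growth_bounded_def by simp_all
  ultimately show ?thesis by blast
qed

end
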